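(* Let $X$ be a proper metric space on which a group $\Gamma$ acts transitively as isometries, and let $D_1$ and $D_2$ be uniformly discrete subsets of $X$. Let $\Sigma=C(X,\mathbb{C})$ be the subshift consisting of all continuous functions of the abstract pattern space $\mathrm{Map}(X,\mathbb{C},0)$ over $(X,\Gamma)$, and for $i=1,2$ let $\Sigma_{D_i}=\{f\in\Sigma\mid f \text{ is locally derivable from } D_i\}$. Then $D_1$ and $D_2$ are mutually locally derivable if and only if $\Sigma_{D_1}=\Sigma_{D_2}$.
   Context: $B(x,r)$ denotes the closed ball; a metric space is proper if all closed balls are compact; $\mathrm{Cl}(X)$ is the set of closed subsets of $X$. Abstract pattern space over $(X,\Gamma)$ ($\Gamma$ acting on $X$ by homeomorphisms): a non-empty set $\Pi$ with a map $\Pi\times\mathrm{Cl}(X)\to\Pi$, $(\mathcal{P},C)\mapsto\mathcal{P}\wedge C$ and an action of $\Gamma$ on $\Pi$ such that (1) $(\mathcal{P}\wedge C_1)\wedge C_2=\mathcal{P}\wedge(C_1\cap C_2)$; (2) for each $\mathcal{P}\in\Pi$ there is a (unique) closed set $\operatorname{supp}\mathcal{P}$ with $\mathcal{P}\wedge C=\mathcal{P}\iff C\supset\operatorname{supp}\mathcal{P}$ for all $C\in\mathrm{Cl}(X)$; (3) $(\gamma\mathcal{P})\wedge(\gamma C)=\gamma(\mathcal{P}\wedge C)$. A subshift is a non-empty $\Gamma$-invariant subset. The two instances used here: (i) the set $\mathrm{UD}(X)$ of all uniformly discrete subsets $D$ of $X$ (i.e. for some $r>0$, $\rho(x,y)>r$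 for all distinct $x,y\in D$), with $D\wedge C=D\cap C$ and $\gamma D=\{\gamma x\mid x\in D\}$; (ii) $\mathrm{Map}(X,\mathbb{C},0)$, the set of all maps $f\colon X\to\mathbb{C}$, with $(f\wedge C)(x)=f(x)$ for $x\in C$ and $(f\wedge C)(x)=0$ for $x\notin C$, and $(\gamma f)(x)=f(\gamma^{-1}x)$. Local derivability: for abstract patterns $\mathcal{P}_1,\mathcal{P}_2$ in abstract pattern spaces over $(X,\Gamma)$, $(Y,\Gamma)$ ($\Gamma$ acting by isometries on proper metric spaces $X,Y$), $\mathcal{P}_2$ is locally derivable from $\mathcal{P}_1$ if there are $x_0\in X$, $y_0\in Y$, $R_0\geqq0$ such that for all $\gamma,\eta\in\Gamma$, $R\geqq0$: $(\gamma\mathcal{P}_1)\wedge B(x_0,R+R_0)=(\eta\mathcal{P}_1)\wedge B(x_0,R+R_0)$ implies $(\gamma\mathcal{P}_2)\wedge B(y_0,R)=(\eta\mathcal{P}_2)\wedge B(y_0,R)$. They are mutually locally derivable if each is locally derivable from the other. (Functions in $\mathrm{Map}(X,\mathbb{C},0)$ locally derivable from $\mathcal{P}$ are called $\mathcal{P}$-equivariant.) *)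

theory Defs
  imports "HOL-Analysis.Analysis" "HOL-Algebra.Group_Action"
begin

definition proper_metric :: "'x::metric_space itself \<Rightarrow> bool"
  where "proper_metric _ \<longleftrightarrow> (\<forall>(x::'x) r. compact (cball x r))"

definition isometric_action :: "('g, 'm) monoid_scheme \<Rightarrow> ('g \<Rightarrow> 'x::metric_space \<Rightarrow> 'x) \<Rightarrow> bool"
  where "isometric_action G \<phi> \<longleftrightarrow>
    group_action G UNIV \<phi> \<and> (\<forall>g\<in>carrier G. \<forall>x y. dist (\<phi> g x) (\<phi> g y) = dist x y)"

record ('x, 'g, 'p) pattern_space =
  patterns :: "'p set"
  wedge :: "'p \<Rightarrow> 'x set \<Rightarrow> 'p"
  act :: "'g \<Rightarrow> 'p \<Rightarrow> 'p"

locale abstract_pattern_space =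
  base: group_action G "UNIV :: 'x set" \<phi> + pat: group_action G "patterns S" "act S"
  for G :: "('g, 'm) monoid_scheme"
    and \<phi> :: "'g \<Rightarrow> 'x::topological_space \<Rightarrow> 'x"
    and S :: "('x, 'g, 'p) pattern_space" +
  assumes homeo: "g \<in> carrier G \<Longrightarrow> \<exists>h. homeomorphism UNIV UNIV (\<phi> g) h"
    and nonempty: "patterns S \<noteq> {}"
    and cut_closed: "\<lbrakk>P \<in> patterns S; closed C\<rbrakk> \<Longrightarrow> wedge S P C \<in> patterns S"
    and cut_cut: "\<lbrakk>P \<in> patterns S; closed C1; closed C2\<rbrakk>
      \<Longrightarrow> wedge S (wedge S P C1) C2 = wedge S P (C1 \<inter> C2)"
    and support: "P \<in> patterns S
      \<Longrightarrow> \<exists>!A. closed A \<and> (\<forall>C. closed C \<longrightarrow> (wedge S P C = P \<longleftrightarrow> A \<subseteq> C))"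
    and cut_act: "\<lbrakk>g \<in> carrier G; P \<in> patterns S; closed C\<rbrakk>
      \<Longrightarrow> wedge S (act S g P) (\<phi> g ` C) = act S g (wedge S P C)"

definition subshift :: "('g, 'm) monoid_scheme \<Rightarrow> ('x, 'g, 'p) pattern_space \<Rightarrow> 'p set \<Rightarrow> bool"
  where "subshift G S \<Sigma> \<longleftrightarrow>
    \<Sigma> \<noteq> {} \<and> \<Sigma> \<subseteq> patterns S \<and> (\<forall>g\<in>carrier G. \<forall>P\<in>\<Sigma>. act S g P \<in> \<Sigma>)"

text \<open>The two spaces may lie over different metric spaces, but the group is the same.\<close>

definition locally_derivable ::
  "('g, 'm) monoid_scheme \<Rightarrow> ('x::metric_space, 'g, 'p) pattern_space \<Rightarrow> 'p
    \<Rightarrow> ('y::metric_space, 'g, 'q) pattern_space \<Rightarrow> 'q \<Rightarrow> bool"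
  \<comment> \<open>\<open>locally_derivable G S P T Q\<close>: the pattern \<open>Q\<close> of \<open>T\<close> is locally derivable from
    the pattern \<open>P\<close> of \<open>S\<close>.\<close>
  where "locally_derivable G S P T Q \<longleftrightarrow>
    (\<exists>x0 y0. \<exists>R0\<ge>0. \<forall>\<gamma>\<in>carrier G. \<forall>\<eta>\<in>carrier G. \<forall>R\<ge>0.
      wedge S (act S \<gamma> P) (cball x0 (R + R0)) = wedge S (act S \<eta> P) (cball x0 (R + R0))
      \<longrightarrow> wedge T (act T \<gamma> Q) (cball y0 R) = wedge T (act T \<eta> Q) (cball y0 R))"

definition mutually_locally_derivable ::
  "('g, 'm) monoid_scheme \<Rightarrow> ('x::metric_space, 'g, 'p) pattern_space \<Rightarrow> 'p
    \<Rightarrow> ('y::metric_space, 'g, 'q) pattern_space \<Rightarrow> 'q \<Rightarrow> bool"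
  where "mutually_locally_derivable G S P T Q \<longleftrightarrow>
    locally_derivable G S P T Q \<and> locally_derivable G T Q S P"

text \<open>The library's \<open>group_action\<close> wants group elements to act by functions that are
  undefined outside the carrier, hence the restriction in \<open>UD\<close>.\<close>

definition UD :: "('g \<Rightarrow> 'x::metric_space \<Rightarrow> 'x) \<Rightarrow> ('x, 'g, 'x set) pattern_space"
  where "UD \<phi> = \<lparr>patterns = {D. uniform_discrete D},
    wedge = (\<lambda>D C. D \<inter> C),
    act = (\<lambda>g. \<lambda>D\<in>{D. uniform_discrete D}. \<phi> g ` D)\<rparr>"

definition Map0 :: "('g, 'm) monoid_scheme \<Rightarrow> ('g \<Rightarrow> 'x \<Rightarrow> 'x)
    \<Rightarrow> ('x, 'g, 'x \<Rightarrow> complex) pattern_space"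
  where "Map0 G \<phi> = \<lparr>patterns = UNIV,
    wedge = (\<lambda>f C x. if x \<in> C then f x else 0),
    act = (\<lambda>g f x. f (\<phi> (inv\<^bsub>G\<^esub> g) x))\<rparr>"

definition continuous_maps :: "('x::topological_space \<Rightarrow> complex) set"
  where "continuous_maps = {f. continuous_on UNIV f}"

definition derivable_maps :: "('g, 'm) monoid_scheme \<Rightarrow> ('g \<Rightarrow> 'x::metric_space \<Rightarrow> 'x)
    \<Rightarrow> ('x \<Rightarrow> complex) set \<Rightarrow> 'x set \<Rightarrow> ('x \<Rightarrow> complex) set"
  where "derivable_maps G \<phi> \<Sigma> D = {f \<in> \<Sigma>. locally_derivable G (UD \<phi>) D (Map0 G \<phi>) f}"


section \<open>The instances are abstract pattern spaces\<close>

lemma uniform_discrete_strict: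
  "uniform_discrete D \<longleftrightarrow> (\<exists>r>0. \<forall>x\<in>D. \<forall>y\<in>D. x \<noteq> y \<longrightarrow> dist x y > r)"
proof
  assume "uniform_discrete D"
  then obtain e where e: "e > 0" "\<forall>x\<in>D. \<forall>y\<in>D. dist x y < e \<longrightarrow> x = y"
    unfolding uniform_discrete_def by blast
  have "dist x y > e / 2" if "x \<in> D" "y \<in> D" "x \<noteq> y" for x y
  proof -
    have "dist x y \<ge> e" using e that by (meson not_le)
    then show ?thesis using e(1) by linarith
  qed
  then show "\<exists>r>0. \<forall>x\<in>D. \<forall>y\<in>D. x \<noteq> y \<longrightarrow> dist x y > r"
    using e(1) by (intro exI[of _ "e / 2"]) auto
next
  assume "\<exists>r>0. \<forall>x\<in>D. \<forall>y\<in>D. x \<noteq> y \<longrightarrow> dist x y > r"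
  then show "uniform_discrete D"
    unfolding uniform_discrete_def by (meson less_asym)
qed

lemma group_actionI:
  fixes G (structure)
  assumes "group G"
    and closed: "\<And>g x. \<lbrakk>g \<in> carrier G; x \<in> E\<rbrakk> \<Longrightarrow> \<phi> g x \<in> E"
    and ext: "\<And>g. g \<in> carrier G \<Longrightarrow> \<phi> g \<in> extensional E"
    and one: "\<And>x. x \<in> E \<Longrightarrow> \<phi> \<one> x = x"
    and mult: "\<And>g h x. \<lbrakk>g \<in> carrier G; h \<in> carrier G; x \<in> E\<rbrakk> \<Longrightarrow> \<phi> (g \<otimes> h) x = \<phi> g (\<phi> h x)"
  shows "group_action G E \<phi>"
proof -
  interpret group G by fact
  have inv1: "\<phi> (inv g) (\<phi> g x) = x" if "g \<in> carrier G" "x \<in> E" for g x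
    using mult[of "inv g" g x] that one by simp
  have inv2: "\<phi> g (\<phi> (inv g) x) = x" if "g \<in> carrier G" "x \<in> E" for g x
    using mult[of g "inv g" x] that one by simp
  have Bij: "\<phi> g \<in> Bij E" if g: "g \<in> carrier G" for g
  proof -
    have "bij_betw (\<phi> g) E E"
      by (rule bij_betw_byWitness[where f' = "\<phi> (inv g)"])
        (use g closed inv1 inv2 in auto)
    then show ?thesis using ext g by (simp add: Bij_def)
  qed
  have "\<phi> \<in> hom G (BijGroup E)"
  proof (rule homI)
    fix g h assume gh: "g \<in> carrier G" "h \<in> carrier G"
    have "\<phi> (g \<otimes> h) = compose E (\<phi> g) (\<phi> h)"
    proof (rule extensionalityI[of _ E])
      show "\<phi> (g \<otimes> h) \<in> extensional E" using gh ext by simp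
      show "compose E (\<phi> g) (\<phi> h) \<in> extensional E" by (rule compose_extensional)
    qed (use gh mult in \<open>simp add: compose_eq\<close>)
    then show "\<phi> (g \<otimes> h) = \<phi> g \<otimes>\<^bsub>BijGroup E\<^esub> \<phi> h"
      using gh Bij by (simp add: BijGroup_def)
  qed (use Bij in \<open>simp add: BijGroup_def\<close>)
  then show ?thesis
    unfolding group_action_def group_hom_def group_hom_axioms_def
    using group_BijGroup \<open>group G\<close> by blast
qed

lemma isometric_action_facts:
  fixes G (structure) and \<phi> :: "'g \<Rightarrow> 'x::metric_space \<Rightarrow> 'x"
  assumes "isometric_action G \<phi>"
  shows "group_action G UNIV \<phi>"
    and "group G"
    and "\<phi> \<one> x = x"
    and "\<lbrakk>g \<in> carrier G; h \<in> carrier G\<rbrakk> \<Longrightarrow> \<phi> (g \<otimes> h) x = \<phi> g (\<phi> h x)"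
    and "g \<in> carrier G \<Longrightarrow> \<phi> (inv g) (\<phi> g x) = x"
    and "g \<in> carrier G \<Longrightarrow> \<phi> g (\<phi> (inv g) x) = x"
    and "g \<in> carrier G \<Longrightarrow> dist (\<phi> g x) (\<phi> g y) = dist x y"
    and "g \<in> carrier G \<Longrightarrow> continuous_on A (\<phi> g)"
    and "g \<in> carrier G \<Longrightarrow> homeomorphism UNIV UNIV (\<phi> g) (\<phi> (inv g))"
proof -
  show ga: "group_action G UNIV \<phi>" using assms by (simp add: isometric_action_def)
  interpret group_action G UNIV \<phi> by fact
  show gr: "group G" using group_hom group_hom.axioms(1) by blast
  interpret group G by fact
  show one: "\<phi> \<one> x = x" for x using id_eq_one by (metis UNIV_I restrict_apply')
  show mult: "\<phi> (g \<otimes> h) x = \<phi> g (\<phi> h x)" if "g \<in> carrier G" "h \<in> carrier G" for g h x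
    using composition_rule that by simp
  show i1: "\<phi> (inv g) (\<phi> g x) = x" if "g \<in> carrier G" for g x
    using mult[of "inv g" g x] that one by simp
  show i2: "\<phi> g (\<phi> (inv g) x) = x" if "g \<in> carrier G" for g x
    using mult[of g "inv g" x] that one by simp
  show d: "dist (\<phi> g x) (\<phi> g y) = dist x y" if "g \<in> carrier G" for g x y
    using assms that by (simp add: isometric_action_def)
  show c: "continuous_on A (\<phi> g)" if "g \<in> carrier G" for g A
    unfolding continuous_on_iff d[OF that] by blast
  show "homeomorphism UNIV UNIV (\<phi> g) (\<phi> (inv g))" if g: "g \<in> carrier G" for g
    by (intro homeomorphismI) (use g c i1 i2 in auto)
qed

lemma uniform_discrete_image:
  fixes G (structure)
  assumes "isometric_action G \<phi>" "g \<in> carrier G" "uniform_discrete D"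
  shows "uniform_discrete (\<phi> g ` D)"
proof -
  obtain e where "e > 0" "\<forall>x\<in>D. \<forall>y\<in>D. dist x y < e \<longrightarrow> x = y"
    using assms(3) unfolding uniform_discrete_def by blast
  then show ?thesis
    unfolding uniform_discrete_def
    by (intro exI[of _ e]) (auto simp: isometric_action_facts(7)[OF assms(1,2)])
qed

proposition abstract_pattern_space_UD:
  fixes G (structure) and \<phi> :: "'g \<Rightarrow> 'x::metric_space \<Rightarrow> 'x"
  assumes iso: "isometric_action G \<phi>"
  shows "abstract_pattern_space G \<phi> (UD \<phi>)"
proof -
  note f = isometric_action_facts[OF iso]
  have ud: "group_action G (patterns (UD \<phi>)) (act (UD \<phi>))"
  proof (rule group_actionI[OF f(2)])
    fix D assume D: "D \<in> patterns (UD \<phi>)"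
    show "act (UD \<phi>) \<one> D = D"
      using D by (simp add: UD_def f(3))
    fix g assume g: "g \<in> carrier G"
    show "act (UD \<phi>) g D \<in> patterns (UD \<phi>)"
      using D uniform_discrete_image[OF iso g] by (simp add: UD_def)
    fix h assume h: "h \<in> carrier G"
    show "act (UD \<phi>) (g \<otimes> h) D = act (UD \<phi>) g (act (UD \<phi>) h D)"
      using D uniform_discrete_image[OF iso h] g h by (simp add: UD_def f(4) image_image)
  qed (simp add: UD_def)
  show ?thesis
  proof (intro abstract_pattern_space.intro abstract_pattern_space_axioms.intro f(1) ud)
    show "\<exists>h. homeomorphism UNIV UNIV (\<phi> g) h" if "g \<in> carrier G" for g
      using f(9)[OF that] by blast
    show "patterns (UD \<phi>) \<noteq> {}" by (auto simp: UD_def intro: uniform_discrete_empty)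
    show "wedge (UD \<phi>) P C \<in> patterns (UD \<phi>)" if "P \<in> patterns (UD \<phi>)" for P C
      using that by (auto simp: UD_def uniform_discrete_def)
    show "wedge (UD \<phi>) (wedge (UD \<phi>) P C1) C2 = wedge (UD \<phi>) P (C1 \<inter> C2)" for P C1 C2
      by (simp add: UD_def Int_assoc)
    show "\<exists>!A. closed A \<and> (\<forall>C. closed C \<longrightarrow> (wedge (UD \<phi>) P C = P \<longleftrightarrow> A \<subseteq> C))" for P
    proof (rule ex1I[of _ "closure P"])
      show *: "closed (closure P) \<and>
          (\<forall>C. closed C \<longrightarrow> (wedge (UD \<phi>) P C = P \<longleftrightarrow> closure P \<subseteq> C))"
      proof -
        have "wedge (UD \<phi>) P C = P \<longleftrightarrow> P \<subseteq> C" for C by (auto simp: UD_def)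
        then show ?thesis by (meson closed_closure closure_minimal closure_subset order_trans)
      qed
      show "A = closure P"
        if "closed A \<and> (\<forall>C. closed C \<longrightarrow> (wedge (UD \<phi>) P C = P \<longleftrightarrow> A \<subseteq> C))" for A
        using that * by (meson order_refl subset_antisym)
    qed
    show "wedge (UD \<phi>) (act (UD \<phi>) g P) (\<phi> g ` C) = act (UD \<phi>) g (wedge (UD \<phi>) P C)"
      if g: "g \<in> carrier G" and P: "P \<in> patterns (UD \<phi>)" for g P C
    proof -
      have "inj (\<phi> g)" using f(5)[OF g] by (metis injI)
      moreover have "uniform_discrete (P \<inter> C)"
        using P by (auto simp: UD_def uniform_discrete_def)
      ultimately show ?thesis using P by (simp add: UD_def image_Int)
    qed
  qed
qed

proposition abstract_pattern_space_Map0: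
  fixes G (structure) and \<phi> :: "'g \<Rightarrow> 'x::metric_space \<Rightarrow> 'x"
  assumes iso: "isometric_action G \<phi>"
  shows "abstract_pattern_space G \<phi> (Map0 G \<phi>)"
proof -
  note f = isometric_action_facts[OF iso]
  interpret group G by (rule f(2))
  have ma: "group_action G (patterns (Map0 G \<phi>)) (act (Map0 G \<phi>))"
    by (rule group_actionI[OF f(2)]) (simp_all add: Map0_def f(3,4) inv_mult_group)
  show ?thesis
  proof (intro abstract_pattern_space.intro abstract_pattern_space_axioms.intro f(1) ma)
    show "\<exists>h. homeomorphism UNIV UNIV (\<phi> g) h" if "g \<in> carrier G" for g
      using f(9)[OF that] by blast
    show "patterns (Map0 G \<phi>) \<noteq> {}" by (simp add: Map0_def)
    show "wedge (Map0 G \<phi>) P C \<in> patterns (Map0 G \<phi>)" for P C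
      by (simp add: Map0_def)
    show "wedge (Map0 G \<phi>) (wedge (Map0 G \<phi>) P C1) C2 = wedge (Map0 G \<phi>) P (C1 \<inter> C2)" for P C1 C2
      by (auto simp: Map0_def)
    show "\<exists>!A. closed A \<and> (\<forall>C. closed C \<longrightarrow> (wedge (Map0 G \<phi>) P C = P \<longleftrightarrow> A \<subseteq> C))" for P
    proof (rule ex1I[of _ "closure {x. P x \<noteq> 0}"])
      have "wedge (Map0 G \<phi>) P C = P \<longleftrightarrow> {x. P x \<noteq> 0} \<subseteq> C" for C
        by (auto simp: Map0_def fun_eq_iff)
      then show *: "closed (closure {x. P x \<noteq> 0}) \<and>
          (\<forall>C. closed C \<longrightarrow> (wedge (Map0 G \<phi>) P C = P \<longleftrightarrow> closure {x. P x \<noteq> 0} \<subseteq> C))"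
        by (meson closed_closure closure_minimal closure_subset order_trans)
      show "A = closure {x. P x \<noteq> 0}"
        if "closed A \<and> (\<forall>C. closed C \<longrightarrow> (wedge (Map0 G \<phi>) P C = P \<longleftrightarrow> A \<subseteq> C))" for A
        using that * by (meson order_refl subset_antisym)
    qed
    show "wedge (Map0 G \<phi>) (act (Map0 G \<phi>) g P) (\<phi> g ` C) = act (Map0 G \<phi>) g (wedge (Map0 G \<phi>) P C)"
      if g: "g \<in> carrier G" for g P C
    proof -
      have "x \<in> \<phi> g ` C \<longleftrightarrow> \<phi> (inv g) x \<in> C" for x
        using f(5,6)[OF g] by (metis imageE imageI)
      then show ?thesis by (simp add: Map0_def)
    qed
  qed
qed

proposition subshift_continuous_maps:
  fixes G (structure) and \<phi> :: "'g \<Rightarrow> 'x::metric_space \<Rightarrow> 'x"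
  assumes iso: "isometric_action G \<phi>"
  shows "subshift G (Map0 G \<phi>) continuous_maps"
proof -
  note f = isometric_action_facts[OF iso]
  interpret group G by (rule f(2))
  have "continuous_on UNIV (\<lambda>x. P (\<phi> (inv g) x))"
    if "continuous_on UNIV P" "g \<in> carrier G" for P :: "'x \<Rightarrow> complex" and g
    by (rule continuous_on_compose2[OF that(1) f(8)]) (use that in auto)
  moreover have "(\<lambda>_. 0) \<in> (continuous_maps :: ('x \<Rightarrow> complex) set)"
    by (simp add: continuous_maps_def)
  ultimately show ?thesis
    unfolding subshift_def by (auto simp: continuous_maps_def Map0_def)
qed

end

theory Submission
  imports Defs
begin

text \<open>
  A uniformly discrete set \<open>D\<close> can be encoded in a continuous function that carries the same local
  information: \<open>D\<close> is closed, so the tent function \<open>x \<mapsto> max 0 (1 - dist(x, D))\<close> takes the value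
  \<open>1\<close> exactly on \<open>D\<close>. Thus \<open>D\<close> is read off from it pointwise, and its value at \<open>x\<close> is determined by
  the part of \<open>D\<close> inside the unit ball around \<open>x\<close>. As the action is isometric, translating \<open>D\<close>
  translates the tent function, so \<open>D\<close> and its tent function are mutually locally derivable
  (\<open>tent_locally_derivable\<close> and \<open>locally_derivable_from_tent\<close>).

  Given this and transitivity of local derivability (\<open>locally_derivable_trans\<close>), the theorem is
  formal. If \<open>D1\<close> and \<open>D2\<close> derive each other, a function derivable from one is derivable from the
  other. Conversely, if the two sets of equivariant functions coincide, the tent function of \<open>D1\<close>
  is derivable from \<open>D2\<close>, and \<open>D1\<close> is derivable from its tent function; hence \<open>D1\<close> is derivable
  from \<open>D2\<close>, and symmetrically.
\<close>

lemma (in abstract_pattern_space) wedge_eq_mono: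
  assumes "P \<in> patterns S" "Q \<in> patterns S" "closed C" "closed C'" "C' \<subseteq> C"
    and "wedge S P C = wedge S Q C"
  shows "wedge S P C' = wedge S Q C'"
  using assms cut_cut[of P C C'] cut_cut[of Q C C'] by (simp add: Int_absorb1)

text \<open>The two derivations may use different base points in the middle space; a ball around one
  is contained in a ball around the other whose radius is larger by their distance.\<close>

lemma locally_derivable_trans:
  fixes \<psi> :: "'g \<Rightarrow> 'y::metric_space \<Rightarrow> 'y" and T :: "('y, 'g, 'q) pattern_space"
  assumes "abstract_pattern_space G \<psi> T" and Q: "Q \<in> patterns T"
    and PQ: "locally_derivable G S P T Q" and QV: "locally_derivable G T Q U V"
  shows "locally_derivable G S P U V"
proof -
  interpret abstract_pattern_space G \<psi> T by fact
  obtain x0 y0 R0 where R0: "R0 \<ge> 0" and PQ: "\<And>\<gamma> \<eta> R. \<lbrakk>\<gamma> \<in> carrier G; \<eta> \<in> carrier G; R \<ge> 0;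
      wedge S (act S \<gamma> P) (cball x0 (R + R0)) = wedge S (act S \<eta> P) (cball x0 (R + R0))\<rbrakk>
      \<Longrightarrow> wedge T (act T \<gamma> Q) (cball y0 R) = wedge T (act T \<eta> Q) (cball y0 R)"
    using PQ unfolding locally_derivable_def by blast
  obtain y1 z1 R1 where R1: "R1 \<ge> 0" and QV: "\<And>\<gamma> \<eta> R. \<lbrakk>\<gamma> \<in> carrier G; \<eta> \<in> carrier G; R \<ge> 0;
      wedge T (act T \<gamma> Q) (cball y1 (R + R1)) = wedge T (act T \<eta> Q) (cball y1 (R + R1))\<rbrakk>
      \<Longrightarrow> wedge U (act U \<gamma> V) (cball z1 R) = wedge U (act U \<eta> V) (cball z1 R)"
    using QV unfolding locally_derivable_def by blast
  define R2 where "R2 = R1 + dist y0 y1 + R0"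
  have "wedge U (act U \<gamma> V) (cball z1 R) = wedge U (act U \<eta> V) (cball z1 R)"
    if g: "\<gamma> \<in> carrier G" "\<eta> \<in> carrier G" and R: "R \<ge> 0"
      and eq: "wedge S (act S \<gamma> P) (cball x0 (R + R2)) = wedge S (act S \<eta> P) (cball x0 (R + R2))"
    for \<gamma> \<eta> R
  proof (rule QV[OF g R])
    have in_T: "act T \<gamma> Q \<in> patterns T" "act T \<eta> Q \<in> patterns T"
      using Q g by (auto intro: pat.element_image)
    have "wedge T (act T \<gamma> Q) (cball y0 (R + R1 + dist y0 y1))
        = wedge T (act T \<eta> Q) (cball y0 (R + R1 + dist y0 y1))"
      using eq R R1 by (intro PQ g) (simp_all add: R2_def add.assoc)
    moreover have "cball y1 (R + R1) \<subseteq> cball y0 (R + R1 + dist y0 y1)"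
    proof
      fix y assume "y \<in> cball y1 (R + R1)"
      then show "y \<in> cball y0 (R + R1 + dist y0 y1)"
        using dist_triangle[of y0 y y1] by simp
    qed
    ultimately show "wedge T (act T \<gamma> Q) (cball y1 (R + R1))
        = wedge T (act T \<eta> Q) (cball y1 (R + R1))"
      using wedge_eq_mono[OF in_T] by blast
  qed
  moreover have "R2 \<ge> 0" using R0 R1 by (simp add: R2_def)
  ultimately show ?thesis unfolding locally_derivable_def by blast
qed

text \<open>The case distinction implements the convention that every point is infinitely far from the
  empty set, whereas \<^term>\<open>infdist x {}\<close> is \<open>0\<close>.\<close>

definition tent :: "'x::metric_space set \<Rightarrow> 'x \<Rightarrow> real"
  where "tent D x = (if D = {} then 0 else max 0 (1 - infdist x D))"

lemma continuous_on_tent: "continuous_on A (tent D)"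
  by (cases "D = {}") (auto simp: tent_def[abs_def] intro!: continuous_intros)

lemma tent_eq_1_iff: "closed D \<Longrightarrow> tent D x = 1 \<longleftrightarrow> x \<in> D"
  by (auto simp: tent_def max_def in_closed_iff_infdist_zero)

text \<open>A larger value of the tent function at \<open>x\<close> needs a closer point, necessarily one at
  distance less than \<open>1\<close>.\<close>

lemma tent_mono_local:
  assumes "D \<inter> cball x 1 \<subseteq> E"
  shows "tent D x \<le> tent E x"
proof (rule ccontr)
  assume less: "\<not> tent D x \<le> tent E x"
  then have "D \<noteq> {}" "infdist x D < 1"
    by (auto simp: tent_def max_def split: if_splits)
  moreover have "E \<noteq> {} \<Longrightarrow> infdist x D < infdist x E"
    using less by (auto simp: tent_def max_def split: if_splits)
  ultimately have "infdist x D < (if E = {} then 1 else min 1 (infdist x E))" by simp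
  then obtain d where d: "d \<in> D" "dist x d < (if E = {} then 1 else min 1 (infdist x E))"
    using \<open>D \<noteq> {}\<close> by (auto simp: infdist_def cINF_less_iff)
  then have "d \<in> E" using assms by (auto split: if_splits)
  then show False using d infdist_le[of d E x] by (auto split: if_splits)
qed

lemma tent_cong_local:
  assumes "D \<inter> cball x 1 = E \<inter> cball x 1"
  shows "tent D x = tent E x"
  by (intro antisym tent_mono_local) (use assms in blast)+

lemma tent_act:
  fixes G (structure)
  assumes "isometric_action G \<phi>" "g \<in> carrier G"
  shows "tent D (\<phi> (inv g) x) = tent (\<phi> g ` D) x"
proof -
  note f = isometric_action_facts[OF assms(1)]
  have "dist (\<phi> (inv g) x) d = dist x (\<phi> g d)" for d
    using f(7)[OF assms(2), of "\<phi> (inv g) x" d] f(6)[OF assms(2)] by simp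
  then show ?thesis by (simp add: tent_def infdist_def image_image)
qed

lemma act_UD: "uniform_discrete D \<Longrightarrow> act (UD \<phi>) g D = \<phi> g ` D"
  by (simp add: UD_def)

lemma wedge_act_tent:
  fixes G (structure)
  assumes "isometric_action G \<phi>" "g \<in> carrier G"
  shows "wedge (Map0 G \<phi>) (act (Map0 G \<phi>) g (\<lambda>x. complex_of_real (tent D x))) C
    = (\<lambda>x. if x \<in> C then complex_of_real (tent (\<phi> g ` D) x) else 0)"
  by (simp add: Map0_def tent_act[OF assms])

text \<open>The value of the tent function at a point of \<open>B(x\<^sub>0, R)\<close> depends on the set only within the unit
  ball around that point, hence within \<open>B(x\<^sub>0, R + 1)\<close>: the derivation radius is \<open>1\<close>.\<close>

lemma tent_locally_derivable:
  assumes iso: "isometric_action G \<phi>" and D: "uniform_discrete D"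
  shows "locally_derivable G (UD \<phi>) D (Map0 G \<phi>) (\<lambda>x. complex_of_real (tent D x))"
proof -
  have "tent (\<phi> \<gamma> ` D) x = tent (\<phi> \<eta> ` D) x"
    if eq: "\<phi> \<gamma> ` D \<inter> cball x0 (R + 1) = \<phi> \<eta> ` D \<inter> cball x0 (R + 1)" and x: "x \<in> cball x0 R"
    for \<gamma> \<eta> x0 x R
  proof (rule tent_cong_local)
    have "cball x 1 \<subseteq> cball x0 (R + 1)"
    proof
      fix y assume "y \<in> cball x 1"
      then show "y \<in> cball x0 (R + 1)" using x dist_triangle[of x0 y x] by simp
    qed
    then show "\<phi> \<gamma> ` D \<inter> cball x 1 = \<phi> \<eta> ` D \<inter> cball x 1" using eq by blast
  qed
  note tent_eq = this
  show ?thesis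
    unfolding locally_derivable_def
  \<comment> \<open>Any common base point of the two spaces will do.\<close>
  proof (rule exI[of _ undefined], rule exI[of _ undefined], rule exI[of _ 1],
      intro conjI ballI allI impI)
    fix \<gamma> \<eta> and R :: real
    assume g: "\<gamma> \<in> carrier G" "\<eta> \<in> carrier G"
      and "wedge (UD \<phi>) (act (UD \<phi>) \<gamma> D) (cball undefined (R + 1))
        = wedge (UD \<phi>) (act (UD \<phi>) \<eta> D) (cball undefined (R + 1))"
    then have "\<phi> \<gamma> ` D \<inter> cball undefined (R + 1) = \<phi> \<eta> ` D \<inter> cball undefined (R + 1)"
      by (simp only: act_UD[OF D]) (simp add: UD_def)
    from tent_eq[OF this]
    show "wedge (Map0 G \<phi>) (act (Map0 G \<phi>) \<gamma> (\<lambda>x. complex_of_real (tent D x))) (cball undefined R)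
        = wedge (Map0 G \<phi>) (act (Map0 G \<phi>) \<eta> (\<lambda>x. complex_of_real (tent D x))) (cball undefined R)"
      unfolding wedge_act_tent[OF iso g(1)] wedge_act_tent[OF iso g(2)] by metis
  qed simp
qed

text \<open>The translates of \<open>D\<close> are again closed, so each is the set where the corresponding translate of
  the tent function is \<open>1\<close>; this is a pointwise reading, with derivation radius \<open>0\<close>.\<close>

lemma locally_derivable_from_tent:
  assumes iso: "isometric_action G \<phi>" and D: "uniform_discrete D"
  shows "locally_derivable G (Map0 G \<phi>) (\<lambda>x. complex_of_real (tent D x)) (UD \<phi>) D"
proof -
  have closed: "closed (\<phi> g ` D)" if "g \<in> carrier G" for g
    using uniform_discrete_image[OF iso that D] by (rule uniform_discrete_imp_closed)
  have "\<phi> \<gamma> ` D \<inter> C = \<phi> \<eta> ` D \<inter> C"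
    if g: "\<gamma> \<in> carrier G" "\<eta> \<in> carrier G"
      and eq: "wedge (Map0 G \<phi>) (act (Map0 G \<phi>) \<gamma> (\<lambda>x. complex_of_real (tent D x))) C
        = wedge (Map0 G \<phi>) (act (Map0 G \<phi>) \<eta> (\<lambda>x. complex_of_real (tent D x))) C"
    for \<gamma> \<eta> C
  proof -
    have "tent (\<phi> \<gamma> ` D) x = tent (\<phi> \<eta> ` D) x" if "x \<in> C" for x
      using fun_cong[OF eq, of x] that by (simp add: wedge_act_tent[OF iso] g)
    then have "x \<in> \<phi> \<gamma> ` D \<longleftrightarrow> x \<in> \<phi> \<eta> ` D" if "x \<in> C" for x
      using that tent_eq_1_iff[OF closed[OF g(1)], of x] tent_eq_1_iff[OF closed[OF g(2)], of x]
      by simp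
    then show ?thesis by blast
  qed
  note cut_eq = this
  show ?thesis
    unfolding locally_derivable_def
  proof (rule exI[of _ undefined], rule exI[of _ undefined], rule exI[of _ 0],
      intro conjI ballI allI impI)
    fix \<gamma> \<eta> and R :: real
    assume g: "\<gamma> \<in> carrier G" "\<eta> \<in> carrier G"
      and eq: "wedge (Map0 G \<phi>) (act (Map0 G \<phi>) \<gamma> (\<lambda>x. complex_of_real (tent D x)))
          (cball undefined (R + 0))
        = wedge (Map0 G \<phi>) (act (Map0 G \<phi>) \<eta> (\<lambda>x. complex_of_real (tent D x)))
          (cball undefined (R + 0))"
    show "wedge (UD \<phi>) (act (UD \<phi>) \<gamma> D) (cball undefined R)
        = wedge (UD \<phi>) (act (UD \<phi>) \<eta> D) (cball undefined R)"
      unfolding act_UD[OF D] using cut_eq[OF g eq] by (simp add: UD_def)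
  qed simp
qed

lemma derivable_maps_mono:
  assumes iso: "isometric_action G \<phi>" and D: "uniform_discrete D"
    and ED: "locally_derivable G (UD \<phi>) E (UD \<phi>) D"
  shows "derivable_maps G \<phi> \<Sigma> D \<subseteq> derivable_maps G \<phi> \<Sigma> E"
proof
  fix f assume f: "f \<in> derivable_maps G \<phi> \<Sigma> D"
  have "D \<in> patterns (UD \<phi>)" using D by (simp add: UD_def)
  note E_trans = locally_derivable_trans[OF abstract_pattern_space_UD[OF iso] this ED]
  from f show "f \<in> derivable_maps G \<phi> \<Sigma> E"
    by (auto simp: derivable_maps_def intro: E_trans)
qed

lemma locally_derivable_if_derivable_maps_subset:
  assumes iso: "isometric_action G \<phi>" and D: "uniform_discrete D"
    and sub: "derivable_maps G \<phi> continuous_maps D \<subseteq> derivable_maps G \<phi> continuous_maps E"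
  shows "locally_derivable G (UD \<phi>) E (UD \<phi>) D"
proof (rule locally_derivable_trans[OF abstract_pattern_space_Map0[OF iso]])
  have "(\<lambda>x. complex_of_real (tent D x)) \<in> continuous_maps"
    by (auto simp: continuous_maps_def intro!: continuous_intros continuous_on_tent)
  with tent_locally_derivable[OF iso D] sub
  show "locally_derivable G (UD \<phi>) E (Map0 G \<phi>) (\<lambda>x. complex_of_real (tent D x))"
    by (auto simp: derivable_maps_def)
  show "(\<lambda>x. complex_of_real (tent D x)) \<in> patterns (Map0 G \<phi>)" by (simp add: Map0_def)
qed (rule locally_derivable_from_tent[OF iso D])

theorem theorem5p6:
  fixes G :: "('g, 'm) monoid_scheme"
    and \<phi> :: "'g \<Rightarrow> 'x::metric_space \<Rightarrow> 'x"
    and D1 D2 :: "'x set"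
  assumes "proper_metric TYPE('x)"
    and "isometric_action G \<phi>"
    and "transitive_action G UNIV \<phi>"
    and "uniform_discrete D1"
    and "uniform_discrete D2"
  shows "mutually_locally_derivable G (UD \<phi>) D1 (UD \<phi>) D2 \<longleftrightarrow>
    derivable_maps G \<phi> continuous_maps D1 = derivable_maps G \<phi> continuous_maps D2"
proof
  assume "mutually_locally_derivable G (UD \<phi>) D1 (UD \<phi>) D2"
  then show "derivable_maps G \<phi> continuous_maps D1 = derivable_maps G \<phi> continuous_maps D2"
    unfolding mutually_locally_derivable_def
    by (intro subset_antisym derivable_maps_mono[OF assms(2)] assms(4,5)) simp_all
next
  assume "derivable_maps G \<phi> continuous_maps D1 = derivable_maps G \<phi> continuous_maps D2"
  then show "mutually_locally_derivable G (UD \<phi>) D1 (UD \<phi>) D2"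
    unfolding mutually_locally_derivable_def
    by (intro conjI locally_derivable_if_derivable_maps_subset[OF assms(2)] assms(4,5)) simp_all
qed

end
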